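(* For all $n\geq 1$, $c_n(1\text{-}32)=F_{2n-1}$.
   Context: A Catalan word of length $n\ge 1$ is a sequence $\pi=\pi_1\cdots\pi_n$ of positive integers with $\pi_1=1$ and $\pi_{i+1}\le \pi_i+1$ for $1\le i\le n-1$; $\mathcal{C}_n$ is the set of these. Two sequences of the same length are order-isomorphic if their corresponding pairs of entries stand in the same relation ($<$, $>$ or $=$). A word $\pi$ contains the vincular pattern $x\text{-}yz$ if there are indices $i<j$ with $j+1\le n$ such that $\pi_i\pi_j\pi_{j+1}$ is order-isomorphic to $xyz$ (the last two letters must be adjacent in $\pi$); otherwise $\pi$ avoids it. $c_n(\tau)$ denotes the number of members of $\mathcal{C}_n$ avoiding $\tau$. $F_n$ is the Fibonacci sequence: $F_0=0$, $F_1=1$, $F_n=F_{n-1}+F_{n-2}$ for $n\ge 2$. *)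

theory Defs
  imports Main "HOL-Number_Theory.Fib"
begin

(* Words are lists of naturals; the letter written pi_i (1 <= i <= n) is w ! (i - 1). *)

definition catalan_word :: "nat list \<Rightarrow> bool" where
  "catalan_word w \<longleftrightarrow>
     w \<noteq> [] \<and> (\<forall>a\<in>set w. 0 < a) \<and> w ! 0 = 1 \<and>
     (\<forall>i. Suc i < length w \<longrightarrow> w ! Suc i \<le> w ! i + 1)"

definition catalan_words :: "nat \<Rightarrow> nat list set" where
  "catalan_words n = {w. catalan_word w \<and> length w = n}"

definition order_isomorphic :: "nat list \<Rightarrow> nat list \<Rightarrow> bool" where
  "order_isomorphic u v \<longleftrightarrow>
     length u = length v \<and>
     (\<forall>i<length u. \<forall>j<length u.
        (u ! i < u ! j \<longleftrightarrow> v ! i < v ! j) \<and>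
        (u ! i > u ! j \<longleftrightarrow> v ! i > v ! j) \<and>
        (u ! i = u ! j \<longleftrightarrow> v ! i = v ! j))"

(* The triple (x, y, z) stands for the vincular pattern x-yz: the letters playing the
   roles of y and z must be adjacent in the word. *)

definition contains_pattern :: "nat list \<Rightarrow> nat \<times> nat \<times> nat \<Rightarrow> bool" where
  "contains_pattern w = (\<lambda>(x, y, z).
     \<exists>i j. i < j \<and> Suc j < length w \<and>
           order_isomorphic [w ! i, w ! j, w ! Suc j] [x, y, z])"

definition num_avoiding :: "nat \<Rightarrow> nat \<times> nat \<times> nat \<Rightarrow> nat" where
  "num_avoiding n \<tau> = card {w \<in> catalan_words n. \<not> contains_pattern w \<tau>}"

end

theory Submission
  imports Defs
begin

text \<open>
  The first letter of a Catalan word is its minimum \<open>1\<close>, so it can play the smallest letter of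
  1-32 for every descent whose lower letter exceeds \<open>1\<close>. Hence a Catalan word avoids 1-32 iff
  each of its descents ends in \<open>1\<close> (lemma \<open>contains_1_32_iff\<close>). Together with the Catalan
  condition this says that a letter \<open>a\<close> is followed by \<open>1\<close>, \<open>a\<close> or \<open>a + 1\<close>, a condition on
  adjacent letters only (lemma \<open>avoids_1_32_iff\<close>).

  Words with such a condition are counted by a transfer recursion. A letter \<open>a > 1\<close> has three
  possible successors, two of them again greater than \<open>1\<close>, whereas for \<open>a = 1\<close> the successors
  \<open>1\<close> and \<open>a\<close> coincide. If \<open>s\<^sub>n\<close> and \<open>t\<^sub>n\<close> are the numbers of continuations of length \<open>n\<close> after
  the letter \<open>1\<close> and after a letter greater than \<open>1\<close>, then \<open>s\<^sub>n\<^sub>+\<^sub>1 = s\<^sub>n + t\<^sub>n\<close> and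
  \<open>t\<^sub>n\<^sub>+\<^sub>1 = s\<^sub>n + 2 t\<^sub>n = s\<^sub>n\<^sub>+\<^sub>1 + t\<^sub>n\<close>, with \<open>s\<^sub>0 = t\<^sub>0 = 1\<close>. So the interleaved sequence
  \<open>s\<^sub>0, t\<^sub>0, s\<^sub>1, t\<^sub>1, \<dots>\<close> is the Fibonacci sequence started at its index \<open>1\<close>
  (lemma \<open>card_continuations\<close>).
\<close>

lemma order_isomorphic_132_iff:
  "order_isomorphic [x, y, z] [1, 3, 2] \<longleftrightarrow> x < z \<and> z < y"
  unfolding order_isomorphic_def by (auto simp: All_less_Suc numeral_3_eq_3)

text \<open>
  The letter playing 1 may always be taken to be the first one. It does not clash with the
  descent, whose upper letter exceeds \<open>1\<close> and so is not the first letter.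
\<close>

lemma contains_1_32_iff:
  assumes "catalan_word w"
  shows "contains_pattern w (1, 3, 2) \<longleftrightarrow>
    (\<exists>j. Suc j < length w \<and> 1 < w ! Suc j \<and> w ! Suc j < w ! j)"
proof
  assume "contains_pattern w (1, 3, 2)"
  then obtain i j where ij: "i < j" "Suc j < length w" "w ! i < w ! Suc j" "w ! Suc j < w ! j"
    unfolding contains_pattern_def prod.case order_isomorphic_132_iff by auto
  moreover have "0 < w ! i"
    using assms ij(1,2) by (auto simp: catalan_word_def)
  ultimately have "1 < w ! Suc j"
    by linarith
  with ij(2,4) show "\<exists>j. Suc j < length w \<and> 1 < w ! Suc j \<and> w ! Suc j < w ! j"
    by blast
next
  assume "\<exists>j. Suc j < length w \<and> 1 < w ! Suc j \<and> w ! Suc j < w ! j"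
  then obtain j where j: "Suc j < length w" "1 < w ! Suc j" "w ! Suc j < w ! j"
    by blast
  have first: "w ! 0 = 1"
    using assms by (simp add: catalan_word_def)
  with j have "0 < j"
    by (cases j) auto
  with j first have "0 < j \<and> Suc j < length w \<and> w ! 0 < w ! Suc j \<and> w ! Suc j < w ! j"
    by simp
  then show "contains_pattern w (1, 3, 2)"
    unfolding contains_pattern_def prod.case order_isomorphic_132_iff by blast
qed

abbreviation avoiding_step :: "nat \<Rightarrow> nat \<Rightarrow> bool" where
  "avoiding_step a b \<equiv> b = 1 \<or> b = a \<or> b = Suc a"

lemma avoiding_step_iff:
  "0 < b \<Longrightarrow> avoiding_step a b \<longleftrightarrow> b \<le> a + 1 \<and> \<not> (1 < b \<and> b < a)"
  by auto

lemma positive_if_successively_avoiding_step: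
  "successively avoiding_step (a # w) \<Longrightarrow> 0 < a \<Longrightarrow> b \<in> set w \<Longrightarrow> 0 < b"
  by (induction w arbitrary: a) auto

lemma avoids_1_32_iff:
  "catalan_word w \<and> \<not> contains_pattern w (1, 3, 2) \<longleftrightarrow>
     (\<exists>v. w = 1 # v \<and> successively avoiding_step (1 # v))"
proof
  assume w: "catalan_word w \<and> \<not> contains_pattern w (1, 3, 2)"
  have "avoiding_step (w ! i) (w ! Suc i)" if "Suc i < length w" for i
  proof -
    have "0 < w ! Suc i" "w ! Suc i \<le> w ! i + 1"
      using w that by (auto simp: catalan_word_def)
    with w that show ?thesis
      using avoiding_step_iff contains_1_32_iff by blast
  qed
  then have "successively avoiding_step w"
    by (simp add: successively_conv_nth)
  moreover have "w = 1 # tl w"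
    using w by (cases w) (auto simp: catalan_word_def)
  ultimately show "\<exists>v. w = 1 # v \<and> successively avoiding_step (1 # v)"
    by metis
next
  assume "\<exists>v. w = 1 # v \<and> successively avoiding_step (1 # v)"
  then obtain v where v: "w = 1 # v" and steps: "successively avoiding_step w"
    by auto
  have pos: "\<forall>a\<in>set w. 0 < a"
    using positive_if_successively_avoiding_step steps unfolding v by auto
  have step: "w ! Suc i \<le> w ! i + 1 \<and> \<not> (1 < w ! Suc i \<and> w ! Suc i < w ! i)"
    if "Suc i < length w" for i
    using steps that by (subst avoiding_step_iff [symmetric]) (auto simp: pos successively_conv_nth)
  have "catalan_word w"
    using pos step by (simp add: catalan_word_def v)
  with step show "catalan_word w \<and> \<not> contains_pattern w (1, 3, 2)"
    using contains_1_32_iff by blast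
qed

definition continuations :: "nat \<Rightarrow> nat \<Rightarrow> nat list set" where
  "continuations a n = {w. length w = n \<and> successively avoiding_step (a # w)}"

lemma continuations_0: "continuations a 0 = {[]}"
  by (auto simp: continuations_def)

lemma continuations_Suc:
  "continuations a (Suc n) = (\<Union>b\<in>{1, a, Suc a}. (#) b ` continuations b n)"
  by (auto simp: continuations_def length_Suc_conv image_iff)

lemma finite_continuations: "finite (continuations a n)"
  by (induction n arbitrary: a) (simp_all add: continuations_0 continuations_Suc)

lemma card_continuations_Suc:
  "card (continuations a (Suc n)) = (\<Sum>b\<in>{1, a, Suc a}. card (continuations b n))"
  unfolding continuations_Suc
  by (subst card_UN_disjoint) (auto simp: finite_continuations card_image)

text \<open>
  Both cases have to be carried through the induction together, since each count feeds the other.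
  That all letters greater than \<open>1\<close> have equally many continuations is part of the claim.
\<close>

lemma card_continuations:
  assumes "0 < a"
  shows "card (continuations a n) = (if a = 1 then fib (2 * n + 1) else fib (2 * n + 2))"
  using assms
proof (induction n arbitrary: a)
  case 0
  show ?case by (simp add: continuations_0)
next
  case (Suc n)
  show ?case
  proof (cases "a = 1")
    case True
    then have "card (continuations a (Suc n)) = fib (2 * n + 1) + fib (2 * n + 2)"
      using Suc.IH by (simp add: card_continuations_Suc)
    then show ?thesis
      using True by simp
  next
    case False
    then have "card (continuations a (Suc n)) =
        fib (2 * n + 1) + (fib (2 * n + 2) + fib (2 * n + 2))"
      using Suc by (simp add: card_continuations_Suc)
    then show ?thesis
      using False by simp
  qed
qed

theorem theorem2p1:
  fixes n :: nat
  assumes "n \<ge> 1"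
  shows "num_avoiding n (1, 3, 2) = fib (2 * n - 1)"
proof -
  obtain m where n: "n = Suc m"
    using assms by (cases n) auto
  have "{w \<in> catalan_words n. \<not> contains_pattern w (1, 3, 2)} =
      {w. (catalan_word w \<and> \<not> contains_pattern w (1, 3, 2)) \<and> length w = n}"
    by (auto simp: catalan_words_def)
  also have "\<dots> = (#) 1 ` continuations 1 m"
    unfolding avoids_1_32_iff by (auto simp: continuations_def n)
  finally have "num_avoiding n (1, 3, 2) = card (continuations 1 m)"
    by (simp add: num_avoiding_def card_image)
  then show ?thesis
    by (simp add: card_continuations n)
qed

end
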